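(* Let $E$ be a real Hausdorff infrabarreled locally convex space and $\mathcal{K}\subset E$ a closed pointed cone. The following are equivalent. (i) There exist $k\in\mathcal{K}$ and $\lambda>0$ such that $\{x^*\in E^*:x^*(k)\le\lambda\}\cap\mathcal{K}^*$ is $\beta(E^*,E)$-bounded. (ii) $0\in\beta(E^*,E)\text{-bPC}(\mathcal{K}^* )\cap\sigma(E^*,E)\text{-s-ext}(\mathcal{K}^* )$. (iii) $0\in\beta(E^*,E)\text{-bPC}(\mathcal{K}^* )$ and $\mathrm{span}(\mathcal{K})$ is dense in $E$. (iv) There exist $n\ge1$, $k_i\in\mathcal{K}$ for $i\in\{1,\dots,n\}$, and $\lambda>0$ such that $\bigcap_{i=1}^n\{x^*\in E^*:x^*(k_i)<\lambda\}\cap\mathcal{K}^*$ is $\beta(E^*,E)$-bounded.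
   Context: $E$ is a real Hausdorff locally convex space with dual $E^*$. $E$ is infrabarreled if every barrel (closed, convex, balanced, absorbent set) in $E$ which absorbs all bounded sets is a neighbourhood of $0$. $\beta(E^*,E)$ is the topology on $E^*$ of uniform convergence on bounded subsets of $E$; $\sigma(E^*,E)$ is the weak-star topology. A cone $\mathcal{K}$ is a (nonempty) convex set with $\lambda k\in\mathcal{K}$ for all $\lambda\ge0$, $k\in\mathcal{K}$; it is pointed if $\mathcal{K}\cap(-\mathcal{K})=\{0\}$. $\mathcal{K}^*=\{x^*\in E^*: x^*(k)\ge0\ \forall k\in\mathcal{K}\}$. For a topology $\tau^*$ on $E^*$, $0\in\tau^*\text{-bPC}(\mathcal{K}^* )$ means there is a $\sigma(E^*,E)$-neighbourhood $W$ of $0$ such that $\mathcal{K}^*\cap W$ is $\tau^*$-bounded. $0\in\sigma(E^*,E)\text{-s-ext}(\mathcal{K}^* )$ means: for all nets $(c_\gamma)_{\gamma\in\Gamma},(c'_\gamma)_{\gamma\in\Gamma}$ in $\mathcal{K}^*$ with $\lim_\gamma\frac{c_\gamma+c'_\gamma}{2}=0$ in $\beta(E^*,E)$, one has $\lim_\gamma c_\gamma=0$ in $\sigma(E^*,E)$. *)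

theory Defs
  imports "HOL-Analysis.Analysis"
begin

section \<open>Locally convex spaces\<close>

text \<open>The Hausdorff axiom is not part of this class; it is supplied by the sort \<^class>\<open>t2_space\<close>.
  Convexity is written out because \<^const>\<open>convex\<close> is not usable in a class specification.\<close>

class locally_convex = real_vector + topological_ab_group_add +
  assumes tendsto_scaleR_Pair: "LIM p (nhds a \<times>\<^sub>F nhds x). fst p *\<^sub>R snd p :> nhds (a *\<^sub>R x)"
    and locally_convex_at_0:
      "open U \<Longrightarrow> 0 \<in> U \<Longrightarrow> \<exists>V. open V \<and> 0 \<in> V \<and> V \<subseteq> U \<and>
         (\<forall>x\<in>V. \<forall>y\<in>V. \<forall>u\<ge>0. \<forall>v\<ge>0. u + v = 1 \<longrightarrow> u *\<^sub>R x + v *\<^sub>R y \<in> V)"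

instance real_normed_vector \<subseteq> locally_convex
proof
  fix a :: real and x :: 'a
  show "LIM p (nhds a \<times>\<^sub>F nhds x). fst p *\<^sub>R snd p :> nhds (a *\<^sub>R x)"
    by (intro tendsto_scaleR filterlim_fst filterlim_snd)
next
  fix U :: "'a set"
  assume "open U" "0 \<in> U"
  then obtain e where "e > 0" "ball 0 e \<subseteq> U"
    by (meson openE)
  then show "\<exists>V. open V \<and> 0 \<in> V \<and> V \<subseteq> U \<and>
      (\<forall>x\<in>V. \<forall>y\<in>V. \<forall>u\<ge>0. \<forall>v\<ge>0. u + v = 1 \<longrightarrow> u *\<^sub>R x + v *\<^sub>R y \<in> V)"
    using convex_ball[of "0::'a" e] unfolding convex_def
    by (intro exI[of _ "ball 0 e"] conjI) auto
qed

definition absorbs :: "'a::real_vector set \<Rightarrow> 'a set \<Rightarrow> bool" where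
  "absorbs U S \<longleftrightarrow> (\<exists>r>0. \<forall>s. \<bar>s\<bar> \<ge> r \<longrightarrow> S \<subseteq> (\<lambda>x. s *\<^sub>R x) ` U)"

definition absorbent :: "'a::real_vector set \<Rightarrow> bool" where
  "absorbent U \<longleftrightarrow> (\<forall>x. absorbs U {x})"

definition balanced :: "'a::real_vector set \<Rightarrow> bool" where
  "balanced U \<longleftrightarrow> (\<forall>c. \<bar>c\<bar> \<le> 1 \<longrightarrow> (\<lambda>x. c *\<^sub>R x) ` U \<subseteq> U)"

definition nbhd_of_0 :: "'a::zero topology \<Rightarrow> 'a set \<Rightarrow> bool" where
  "nbhd_of_0 T W \<longleftrightarrow> (\<exists>U. openin T U \<and> 0 \<in> U \<and> U \<subseteq> W)"

text \<open>Boundedness in the sense of topological vector spaces; the constant \<^const>\<open>bounded\<close> of the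
  library is metric. The topology is an argument because \<open>E\<^sup>*\<close> carries several of them.\<close>

definition tvs_bounded :: "'a::real_vector topology \<Rightarrow> 'a set \<Rightarrow> bool" where
  "tvs_bounded T S \<longleftrightarrow> (\<forall>U. nbhd_of_0 T U \<longrightarrow> absorbs U S)"

definition barrel :: "'a::locally_convex set \<Rightarrow> bool" where
  "barrel B \<longleftrightarrow> closed B \<and> convex B \<and> balanced B \<and> absorbent B"

definition infrabarreled :: "'a::locally_convex itself \<Rightarrow> bool" where
  "infrabarreled TYPE('a) \<longleftrightarrow>
     (\<forall>B::'a set. barrel B \<and> (\<forall>S. tvs_bounded euclidean S \<longrightarrow> absorbs B S)
        \<longrightarrow> nbhd_of_0 euclidean B)"


section \<open>The dual space and its topologies\<close>

typedef (overloaded) 'a cdual =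
  "{f :: 'a::locally_convex \<Rightarrow> real. linear f \<and> continuous_on UNIV f}"
  morphisms dual_apply Abs_cdual
  by (rule exI[of _ "\<lambda>_. 0"]) (simp add: linear_iff)

setup_lifting type_definition_cdual

instantiation cdual :: (locally_convex) real_vector
begin

lift_definition zero_cdual :: "'a cdual" is "\<lambda>_. 0"
  by (simp add: linear_iff)

lift_definition plus_cdual :: "'a cdual \<Rightarrow> 'a cdual \<Rightarrow> 'a cdual" is "\<lambda>f g x. f x + g x"
  by (auto simp: linear_iff algebra_simps intro!: continuous_on_add)

lift_definition minus_cdual :: "'a cdual \<Rightarrow> 'a cdual \<Rightarrow> 'a cdual" is "\<lambda>f g x. f x - g x"
  by (auto simp: linear_iff algebra_simps intro!: continuous_on_diff)

lift_definition uminus_cdual :: "'a cdual \<Rightarrow> 'a cdual" is "\<lambda>f x. - f x"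
  by (auto simp: linear_iff intro!: continuous_on_minus)

lift_definition scaleR_cdual :: "real \<Rightarrow> 'a cdual \<Rightarrow> 'a cdual" is "\<lambda>c f x. c * f x"
  by (auto simp: linear_iff algebra_simps intro!: continuous_on_mult_left)

instance
  by standard (transfer; force simp: algebra_simps)+

end

text \<open>Pointwise convergence on \<open>E\<close>.\<close>

definition weak_star :: "'a::locally_convex cdual topology" where
  "weak_star = pullback_topology UNIV dual_apply (product_topology (\<lambda>_. euclideanreal) UNIV)"

text \<open>Uniform convergence on the bounded subsets of \<open>E\<close>. The sets
  \<open>{g. \<forall>x\<in>B. \<bar>g x - f x\<bar> < e}\<close> are neighbourhoods of \<open>f\<close> but need not be open, so they cannot be
  used as a generating family of open sets.\<close>

definition strong_dual :: "'a::locally_convex cdual topology" where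
  "strong_dual = topology (\<lambda>U. \<forall>f\<in>U. \<exists>B e. tvs_bounded euclidean B \<and> e > 0 \<and>
     {g. \<forall>x\<in>B. \<bar>dual_apply g x - dual_apply f x\<bar> < e} \<subseteq> U)"

lemma absorbs_mono: "absorbs U S \<Longrightarrow> U \<subseteq> V \<Longrightarrow> absorbs V S"
  unfolding absorbs_def by (meson image_mono order_trans)

lemma tvs_bounded_Un:
  assumes "tvs_bounded T A" "tvs_bounded T B"
  shows "tvs_bounded T (A \<union> B)"
  unfolding tvs_bounded_def
proof (intro allI impI)
  fix U assume "nbhd_of_0 T U"
  then have "absorbs U A" "absorbs U B"
    using assms by (auto simp: tvs_bounded_def)
  then obtain r s where "r > 0" "\<forall>t. \<bar>t\<bar> \<ge> r \<longrightarrow> A \<subseteq> (\<lambda>x. t *\<^sub>R x) ` U"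
    and "s > 0" "\<forall>t. \<bar>t\<bar> \<ge> s \<longrightarrow> B \<subseteq> (\<lambda>x. t *\<^sub>R x) ` U"
    unfolding absorbs_def by blast
  then show "absorbs U (A \<union> B)"
    unfolding absorbs_def by (intro exI[of _ "max r s"]) auto
qed

lemma openin_strong_dual:
  fixes U :: "'a::locally_convex cdual set"
  shows "openin strong_dual U \<longleftrightarrow> (\<forall>f\<in>U. \<exists>B e. tvs_bounded euclidean B \<and> e > 0 \<and>
     {g. \<forall>x\<in>B. \<bar>dual_apply g x - dual_apply f x\<bar> < e} \<subseteq> U)"
proof -
  let ?N = "\<lambda>(f :: 'a cdual) B e. {g. \<forall>x\<in>B. \<bar>dual_apply g x - dual_apply f x\<bar> < e}"
  let ?P = "\<lambda>U. \<forall>f\<in>U. \<exists>B e. tvs_bounded euclidean B \<and> e > 0 \<and> ?N f B e \<subseteq> U"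
  have "istopology ?P"
    unfolding istopology_def
  proof (intro conjI allI impI)
    fix S T assume S: "?P S" and T: "?P T"
    show "?P (S \<inter> T)"
    proof
      fix f assume "f \<in> S \<inter> T"
      then have "f \<in> S" "f \<in> T" by auto
      from bspec[OF S this(1)] obtain B d
        where B: "tvs_bounded euclidean B" "d > 0" "?N f B d \<subseteq> S" by (elim exE conjE)
      from bspec[OF T \<open>f \<in> T\<close>] obtain C e
        where C: "tvs_bounded euclidean C" "e > 0" "?N f C e \<subseteq> T" by (elim exE conjE)
      have "?N f (B \<union> C) (min d e) \<subseteq> ?N f B d \<inter> ?N f C e"
        by auto
      also have "\<dots> \<subseteq> S \<inter> T"
        using B(3) C(3) by (rule Int_mono)
      finally show "\<exists>B e. tvs_bounded euclidean B \<and> e > 0 \<and> ?N f B e \<subseteq> S \<inter> T"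
        using tvs_bounded_Un[OF B(1) C(1)] B(2) C(2)
        by (intro exI[of _ "B \<union> C"] exI[of _ "min d e"] conjI) simp_all
    qed
  next
    fix \<K> assume K: "\<forall>S\<in>\<K>. ?P S"
    show "?P (\<Union>\<K>)"
    proof
      fix f assume "f \<in> \<Union>\<K>"
      then obtain S where S: "S \<in> \<K>" "f \<in> S" by blast
      from bspec[OF bspec[OF K S(1)] S(2)] obtain B e
        where B: "tvs_bounded euclidean B" "e > 0" "?N f B e \<subseteq> S" by (elim exE conjE)
      show "\<exists>B e. tvs_bounded euclidean B \<and> e > 0 \<and> ?N f B e \<subseteq> \<Union>\<K>"
        using B(1,2) order_trans[OF B(3) Union_upper[OF S(1)]]
        by (intro exI[of _ B] exI[of _ e] conjI)
    qed
  qed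
  then show ?thesis
    unfolding strong_dual_def by (simp add: topology_inverse')
qed

lemma topspace_strong_dual [simp]: "topspace strong_dual = UNIV"
proof -
  have "tvs_bounded euclidean ({} :: 'a::locally_convex set)"
    by (auto simp: tvs_bounded_def absorbs_def intro: exI[of _ 1])
  then have "openin strong_dual (UNIV :: 'a cdual set)"
    unfolding openin_strong_dual
    by (intro ballI exI[of _ "{}"] exI[of _ "1 :: real"]) simp
  then show ?thesis
    by (metis openin_subset top.extremum_uniqueI)
qed

lemma topspace_weak_star [simp]: "topspace weak_star = UNIV"
  by (simp add: weak_star_def topspace_pullback_topology)

lemma limitin_strong_dual:
  "limitin strong_dual c f F \<longleftrightarrow>
     (\<forall>B. tvs_bounded euclidean B \<longrightarrow>
        uniform_limit B (\<lambda>i. dual_apply (c i)) (dual_apply f) F)"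
  (is "?L \<longleftrightarrow> ?R")
proof
  assume L: ?L
  show ?R
  proof (intro allI impI uniform_limitI)
    fix B :: "'a set" and e :: real
    assume B: "tvs_bounded euclidean B" and e: "e > 0"
    let ?U = "{g. \<exists>d<e. \<forall>x\<in>B. \<bar>dual_apply g x - dual_apply f x\<bar> \<le> d}"
    have "openin strong_dual ?U"
      unfolding openin_strong_dual
    proof
      fix g assume "g \<in> ?U"
      then obtain d where d: "d < e" "\<forall>x\<in>B. \<bar>dual_apply g x - dual_apply f x\<bar> \<le> d" by blast
      have "{h. \<forall>x\<in>B. \<bar>dual_apply h x - dual_apply g x\<bar> < (e - d) / 2} \<subseteq> ?U"
      proof
        fix h assume "h \<in> {h. \<forall>x\<in>B. \<bar>dual_apply h x - dual_apply g x\<bar> < (e - d) / 2}"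
        then have h: "\<bar>dual_apply h x - dual_apply g x\<bar> < (e - d) / 2" if "x \<in> B" for x
          using that by blast
        have "\<bar>dual_apply h x - dual_apply f x\<bar> \<le> (e + d) / 2" if "x \<in> B" for x
          using d(2)[rule_format, OF that] h[OF that] by argo
        then show "h \<in> ?U" using d(1) by (intro CollectI exI[of _ "(e + d) / 2"]) auto
      qed
      then show "\<exists>B' e'. tvs_bounded euclidean B' \<and> e' > 0 \<and>
          {h. \<forall>x\<in>B'. \<bar>dual_apply h x - dual_apply g x\<bar> < e'} \<subseteq> ?U"
        using B d(1) by (intro exI[of _ B] exI[of _ "(e - d) / 2"]) auto
    qed
    moreover have "f \<in> ?U" using e by auto
    ultimately have "eventually (\<lambda>i. c i \<in> ?U) F"
      using L unfolding limitin_def by blast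
    then show "\<forall>\<^sub>F i in F. \<forall>x\<in>B. dist (dual_apply (c i) x) (dual_apply f x) < e"
      by (rule eventually_mono) (force simp: dist_real_def)
  qed
next
  assume R: ?R
  show ?L
    unfolding limitin_def
  proof (intro conjI allI impI)
    fix U assume "openin strong_dual U \<and> f \<in> U"
    then have U: "openin strong_dual U" and "f \<in> U" by auto
    from bspec[OF U[unfolded openin_strong_dual] \<open>f \<in> U\<close>] obtain B e
      where B: "tvs_bounded euclidean B" "e > 0"
        "{g. \<forall>x\<in>B. \<bar>dual_apply g x - dual_apply f x\<bar> < e} \<subseteq> U"
      by (elim exE conjE)
    have "\<forall>\<^sub>F i in F. \<forall>x\<in>B. dist (dual_apply (c i) x) (dual_apply f x) < e"
      using R[rule_format, OF B(1)] B(2) by (simp add: uniform_limit_iff)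
    then show "\<forall>\<^sub>F i in F. c i \<in> U"
      by (rule eventually_mono) (use B(3) in \<open>auto simp: dist_real_def\<close>)
  qed simp
qed

lemma limitin_weak_star:
  "limitin weak_star c f F \<longleftrightarrow> (\<forall>x. ((\<lambda>i. dual_apply (c i) x) \<longlongrightarrow> dual_apply f x) F)"
proof -
  have "limitin weak_star c f F \<longleftrightarrow>
      limitin (product_topology (\<lambda>_. euclideanreal) UNIV) (\<lambda>i. dual_apply (c i)) (dual_apply f) F"
    by (auto simp: limitin_def weak_star_def openin_pullback_topology topspace_pullback_topology)
  then show ?thesis
    by (simp add: limitin_componentwise)
qed


section \<open>Cones\<close>

definition pointed :: "'a::real_vector set \<Rightarrow> bool" where
  "pointed K \<longleftrightarrow> K \<inter> uminus ` K = {0}"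

definition dual_cone :: "'a::locally_convex set \<Rightarrow> 'a cdual set" where
  "dual_cone K = {f. \<forall>k\<in>K. dual_apply f k \<ge> 0}"

definition zero_in_bPC :: "'a::locally_convex cdual topology \<Rightarrow> 'a cdual set \<Rightarrow> bool" where
  "zero_in_bPC T C \<longleftrightarrow> (\<exists>W. nbhd_of_0 weak_star W \<and> tvs_bounded T (C \<inter> W))"


section \<open>Nets\<close>

definition directed_by :: "'i set \<Rightarrow> ('i \<Rightarrow> 'i \<Rightarrow> bool) \<Rightarrow> bool" where
  "directed_by I le \<longleftrightarrow> I \<noteq> {} \<and> (\<forall>i\<in>I. le i i) \<and>
     (\<forall>i\<in>I. \<forall>j\<in>I. \<forall>k\<in>I. le i j \<longrightarrow> le j k \<longrightarrow> le i k) \<and>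
     (\<forall>i\<in>I. \<forall>j\<in>I. \<exists>k\<in>I. le i k \<and> le j k)"

definition net_filter :: "'i set \<Rightarrow> ('i \<Rightarrow> 'i \<Rightarrow> bool) \<Rightarrow> 'i filter" where
  "net_filter I le = (INF i\<in>I. principal {j\<in>I. le i j})"

lemma eventually_net_filter:
  assumes "directed_by I le"
  shows "eventually P (net_filter I le) \<longleftrightarrow> (\<exists>i\<in>I. \<forall>j\<in>I. le i j \<longrightarrow> P j)"
proof -
  have "eventually P (net_filter I le) \<longleftrightarrow>
      (\<exists>i\<in>I. eventually P (principal {j\<in>I. le i j}))"
    unfolding net_filter_def
  proof (rule eventually_INF_base)
    show "I \<noteq> {}" using assms by (simp add: directed_by_def)
    fix i j assume ij: "i \<in> I" "j \<in> I"
    then obtain k where k: "k \<in> I" "le i k" "le j k"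
      using assms unfolding directed_by_def by meson
    then have "{l\<in>I. le k l} \<subseteq> {l\<in>I. le i l} \<inter> {l\<in>I. le j l}"
      using assms ij unfolding directed_by_def by blast
    then show "\<exists>k\<in>I. principal {l\<in>I. le k l} \<le>
        inf (principal {l\<in>I. le i l}) (principal {l\<in>I. le j l})"
      using k(1) by auto
  qed
  then show ?thesis
    by (auto simp: eventually_principal)
qed

text \<open>A definition cannot quantify over the type of the indices of a net, so it is first made a
  parameter and then fixed to be \<^typ>\<open>'a cdual set\<close>, which is large enough to index a
  neighbourhood base. The lemma \<open>zero_in_s_ext_any_index\<close> shows that nets over every
  other index type are covered.\<close>

definition zero_in_s_ext_indexed :: "'i itself \<Rightarrow> 'a::locally_convex cdual set \<Rightarrow> bool" where
  "zero_in_s_ext_indexed TYPE('i) C \<longleftrightarrow>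
     (\<forall>(I :: 'i set) le c c'.
        directed_by I le \<and> (\<forall>i\<in>I. c i \<in> C \<and> c' i \<in> C) \<and>
        limitin strong_dual (\<lambda>i. (1/2) *\<^sub>R (c i + c' i)) 0 (net_filter I le)
        \<longrightarrow> limitin weak_star c 0 (net_filter I le))"

definition zero_in_s_ext :: "'a::locally_convex cdual set \<Rightarrow> bool" where
  "zero_in_s_ext C \<longleftrightarrow> zero_in_s_ext_indexed TYPE('a cdual set) C"

lemma zero_in_s_ext_any_index:
  assumes "zero_in_s_ext (C :: 'a::locally_convex cdual set)"
  shows "zero_in_s_ext_indexed TYPE('i) C"
  unfolding zero_in_s_ext_indexed_def
proof (intro allI impI)
  fix I :: "'i set" and le c c'
  assume *: "directed_by I le \<and> (\<forall>i\<in>I. c i \<in> C \<and> c' i \<in> C) \<and>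
    limitin strong_dual (\<lambda>i. (1/2) *\<^sub>R (c i + c' i)) 0 (net_filter I le)"
  then have dirI: "directed_by I le" by blast
  let ?m = "\<lambda>i. (1/2) *\<^sub>R (c i + c' i)"
  show "limitin weak_star c 0 (net_filter I le)"
  proof (rule ccontr)
    assume "\<not> ?thesis"
    then obtain V where V: "openin weak_star V" "0 \<in> V"
      "\<not> eventually (\<lambda>i. c i \<in> V) (net_filter I le)"
      by (auto simp: limitin_def)
    define N where "N = {U :: 'a cdual set. openin strong_dual U \<and> 0 \<in> U}"
    have "\<exists>i\<in>I. ?m i \<in> U \<and> c i \<notin> V" if "U \<in> N" for U
    proof -
      have "eventually (\<lambda>i. ?m i \<in> U) (net_filter I le)"
        using * that by (auto simp: limitin_def N_def)
      then obtain i0 where i0: "i0 \<in> I" "\<And>j. j \<in> I \<Longrightarrow> le i0 j \<Longrightarrow> ?m j \<in> U"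
        unfolding eventually_net_filter[OF dirI] by blast
      then obtain j where "j \<in> I" "le i0 j" "c j \<notin> V"
        using V(3) unfolding eventually_net_filter[OF dirI] by blast
      then show ?thesis
        using i0(2) by blast
    qed
    then obtain g where g: "\<And>U. U \<in> N \<Longrightarrow> g U \<in> I \<and> ?m (g U) \<in> U \<and> c (g U) \<notin> V"
      by metis
    have "UNIV \<in> N"
      using openin_topspace[of "strong_dual :: 'a cdual topology"] by (simp add: N_def)
    moreover have "U \<inter> W \<in> N" if "U \<in> N" "W \<in> N" for U W
      using that by (simp add: N_def openin_Int)
    ultimately have dir: "directed_by N (\<lambda>U W. W \<subseteq> U)"
      unfolding directed_by_def
      by (metis (no_types, lifting) empty_iff inf_le1 inf_le2 order_refl order_trans)
    have "limitin strong_dual (\<lambda>U. ?m (g U)) 0 (net_filter N (\<lambda>U W. W \<subseteq> U))"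
      unfolding limitin_def eventually_net_filter[OF dir]
    proof (intro conjI allI impI)
      fix U assume "openin strong_dual U \<and> (0 :: 'a cdual) \<in> U"
      then have "U \<in> N" by (simp add: N_def)
      then show "\<exists>i\<in>N. \<forall>j\<in>N. j \<subseteq> i \<longrightarrow> ?m (g j) \<in> U"
        using g by blast
    qed simp
    moreover have "\<forall>U\<in>N. c (g U) \<in> C \<and> c' (g U) \<in> C"
      using g * by blast
    ultimately have "limitin weak_star (\<lambda>U. c (g U)) 0 (net_filter N (\<lambda>U W. W \<subseteq> U))"
      using assms[unfolded zero_in_s_ext_def zero_in_s_ext_indexed_def, rule_format,
          of N "\<lambda>U W. W \<subseteq> U" "\<lambda>U. c (g U)" "\<lambda>U. c' (g U)"] dir
      by blast
    then obtain U where "U \<in> N" "c (g U) \<in> V"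
      using V(1,2) unfolding limitin_def eventually_net_filter[OF dir] by blast
    then show False using g by blast
  qed
qed

end

theory Submission
  imports Defs
begin

text \<open>Since \<open>E\<close> is infrabarreled, \<open>\<beta>(E\<^sup>*,E)\<close>-bounded sets are equicontinuous, and by Hahn--Banach
  \<open>span K\<close> is dense iff no nonzero functional vanishes on \<open>K\<close>. A functional vanishing on \<open>K\<close>
  spans a line inside the slice of (i), and it yields the constant nets \<open>f\<close> and \<open>- f\<close> violating
  s-extremality, so (i) and (ii) both force density. Conversely, if \<open>K\<^sup>* \<inter> W\<close> is bounded with
  \<open>W = {f. |f(x\<^sub>i)| < e}\<close>, equicontinuity allows each \<open>x\<^sub>i\<close> to be replaced by a nearby
  \<open>a\<^sub>i - b\<^sub>i\<close> with \<open>a\<^sub>i, b\<^sub>i \<in> K\<close> (rescale a functional of the cone that leaves \<open>W\<close> back into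
  \<open>W\<close>), and \<open>k = \<Sum>\<^sub>i a\<^sub>i + b\<^sub>i\<close> dominates all of these on \<open>K\<^sup>*\<close>. Finally, if
  \<open>c + c' \<rightarrow> 0\<close> in \<open>K\<^sup>*\<close>, then \<open>0 \<le> c \<le> c + c'\<close> on \<open>K\<close> gives \<open>c \<rightarrow> 0\<close> on \<open>span K\<close>, the net
  enters the slice of (i), and equicontinuity extends the convergence to the closure.\<close>

section \<open>Separation of a point from a closed subspace\<close>

definition sublinear :: "('a::real_vector \<Rightarrow> real) \<Rightarrow> bool" where
  "sublinear q \<longleftrightarrow> (\<forall>x y. q (x + y) \<le> q x + q y) \<and> (\<forall>c\<ge>0. \<forall>x. q (c *\<^sub>R x) = c * q x)"

lemma sublinear_add: "sublinear q \<Longrightarrow> q (x + y) \<le> q x + q y"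
  and sublinear_scaleR: "sublinear q \<Longrightarrow> 0 \<le> c \<Longrightarrow> q (c *\<^sub>R x) = c * q x"
  by (simp_all add: sublinear_def)

lemma sublinear_0: "sublinear q \<Longrightarrow> q 0 = 0"
  using sublinear_scaleR[of q 0 0] by simp

lemma sublinear_uminus_ge: "sublinear q \<Longrightarrow> - q (- x) \<le> q x"
  using sublinear_add[of q x "- x"] by (simp add: sublinear_0)

text \<open>Applying the scaling inequality to \<open>inverse c\<close> and
  \<open>c *\<^sub>R x\<close> gives the reverse inequality, and \<open>q 0 = 0\<close> covers
  \<open>c = 0\<close>.\<close>

lemma sublinearI:
  assumes add: "\<And>x y. q (x + y) \<le> q x + q y"
    and scale: "\<And>c x. c > 0 \<Longrightarrow> q (c *\<^sub>R x) \<le> c * q x"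
    and "q 0 = 0"
  shows "sublinear q"
proof -
  have "q (c *\<^sub>R x) = c * q x" if "c \<ge> 0" for c x
  proof (cases "c = 0")
    case False
    then have "c > 0" using that by simp
    have "q x \<le> inverse c * q (c *\<^sub>R x)"
      using scale[of "inverse c" "c *\<^sub>R x"] \<open>c > 0\<close> by simp
    then have "c * q x \<le> q (c *\<^sub>R x)"
      using \<open>c > 0\<close> by (simp add: field_simps)
    then show ?thesis
      using scale[OF \<open>c > 0\<close>, of x] by simp
  qed (simp add: \<open>q 0 = 0\<close>)
  then show ?thesis
    using add by (simp add: sublinear_def)
qed

text \<open>Oddness turns subadditivity at \<open>- x\<close> and \<open>- y\<close> into
  superadditivity at \<open>x\<close> and \<open>y\<close>, and reduces negative scalars to positive
  ones.\<close>

lemma sublinear_odd_imp_linear: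
  assumes q: "sublinear q" and odd: "\<And>x. q (- x) = - q x"
  shows "linear q"
proof (rule linearI)
  fix x y
  have "q (- x + - y) \<le> q (- x) + q (- y)"
    using q by (rule sublinear_add)
  then have "q x + q y \<le> q (x + y)"
    using odd[of "x + y"] by (simp add: odd)
  then show "q (x + y) = q x + q y"
    using sublinear_add[OF q, of x y] by simp
next
  fix c :: real and x
  show "q (c *\<^sub>R x) = c *\<^sub>R q x"
  proof (cases "c \<ge> 0")
    case False
    then have "q ((- c) *\<^sub>R x) = - c * q x"
      using q by (intro sublinear_scaleR) auto
    then show ?thesis
      using odd[of "c *\<^sub>R x"] by simp
  qed (simp add: sublinear_scaleR[OF q])
qed

text \<open>This is the extension step of Hahn-Banach: \<open>r x\<close> is the infimum of
  \<open>q (x + t *\<^sub>R y) - t * q y\<close> over \<open>t \<ge> 0\<close>. Taking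
  \<open>t = 0\<close> gives \<open>r \<le> q\<close>; taking \<open>t = 1\<close> at
  \<open>- y\<close> gives the last bound. So \<open>r\<close> is strictly smaller than
  \<open>q\<close> unless \<open>q\<close> is odd at \<open>y\<close>.\<close>

lemma sublinear_below:
  assumes q: "sublinear q"
  obtains r where "sublinear r" "\<And>x. r x \<le> q x" "r (- y) \<le> - q y"
proof -
  define r where "r x = (INF t\<in>{0..}. q (x + t *\<^sub>R y) - t * q y)" for x
  \<comment> \<open>The infimum is finite: subadditivity bounds \<open>t * q y\<close> by
    \<open>q (x + t *\<^sub>R y) + q (- x)\<close>.\<close>
  have lower: "- q (- x) \<le> q (x + t *\<^sub>R y) - t * q y" if "t \<ge> 0" for x t
    using sublinear_add[OF q, of "x + t *\<^sub>R y" "- x"] sublinear_scaleR[OF q that, of y]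
    by (simp add: algebra_simps)
  then have bdd: "bdd_below ((\<lambda>t. q (x + t *\<^sub>R y) - t * q y) ` {0..})" for x
    by (intro bdd_belowI2) auto
  have r_le: "r x \<le> q (x + t *\<^sub>R y) - t * q y" if "t \<ge> 0" for x t
    unfolding r_def using that by (intro cINF_lower[OF bdd]) auto
  have r_ge: "z \<le> r x" if "\<And>t. t \<ge> 0 \<Longrightarrow> z \<le> q (x + t *\<^sub>R y) - t * q y" for z x
    unfolding r_def using that by (intro cINF_greatest) auto
  have "sublinear r"
  proof (rule sublinearI)
    fix u v
    \<comment> \<open>The parameters add: \<open>s + t\<close> is admissible for
      \<open>u + v\<close>. The infima over \<open>t\<close> and then over \<open>s\<close> are
      taken afterwards.\<close>
    have "r (u + v) - (q (u + s *\<^sub>R y) - s * q y) \<le> q (v + t *\<^sub>R y) - t * q y"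
      if "s \<ge> 0" "t \<ge> 0" for s t
    proof -
      have "r (u + v) \<le> q ((u + v) + (s + t) *\<^sub>R y) - (s + t) * q y"
        using that by (intro r_le) simp
      also have "(u + v) + (s + t) *\<^sub>R y = (u + s *\<^sub>R y) + (v + t *\<^sub>R y)"
        by (simp add: algebra_simps)
      finally show ?thesis
        using sublinear_add[OF q, of "u + s *\<^sub>R y" "v + t *\<^sub>R y"] by (simp add: algebra_simps)
    qed
    then have "r (u + v) - (q (u + s *\<^sub>R y) - s * q y) \<le> r v" if "s \<ge> 0" for s
      using that by (intro r_ge) auto
    then have "r (u + v) - r v \<le> r u"
      by (intro r_ge) (force simp: algebra_simps)
    then show "r (u + v) \<le> r u + r v" by simp
  next
    fix c :: real and x assume "c > 0"
    have "r (c *\<^sub>R x) / c \<le> r x"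
    proof (rule r_ge)
      fix t :: real assume "t \<ge> 0"
      then have "r (c *\<^sub>R x) \<le> q (c *\<^sub>R x + (c * t) *\<^sub>R y) - (c * t) * q y"
        using \<open>c > 0\<close> by (intro r_le) simp
      also have "c *\<^sub>R x + (c * t) *\<^sub>R y = c *\<^sub>R (x + t *\<^sub>R y)"
        by (simp add: algebra_simps)
      also have "q \<dots> = c * q (x + t *\<^sub>R y)"
        using \<open>c > 0\<close> by (intro sublinear_scaleR[OF q]) simp
      finally show "r (c *\<^sub>R x) / c \<le> q (x + t *\<^sub>R y) - t * q y"
        using \<open>c > 0\<close> by (simp add: field_simps)
    qed
    then show "r (c *\<^sub>R x) \<le> c * r x"
      using \<open>c > 0\<close> by (simp add: field_simps)
  next
    have "r 0 \<le> 0"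
      using r_le[of 0 0] by (simp add: sublinear_0[OF q])
    moreover have "0 \<le> r 0"
      using lower[of _ 0] by (intro r_ge) (simp add: sublinear_0[OF q])
    ultimately show "r 0 = 0" by simp
  qed
  moreover have "r x \<le> q x" for x
    using r_le[of 0 x] by simp
  moreover have "r (- y) \<le> - q y"
    using r_le[of 1 "- y"] by (simp add: sublinear_0[OF q])
  ultimately show ?thesis
    by (rule that)
qed

text \<open>The common bound \<open>p\<close> keeps the infimum finite, since
  \<open>- p (- x) \<le> - q (- x) \<le> q x\<close>. The chain condition gives subadditivity: below
  any two members lies a single member, whose subadditivity can be used.\<close>

lemma sublinear_INF_chain:
  assumes "C \<noteq> {}" and sub: "\<And>q. q \<in> C \<Longrightarrow> sublinear q"
    and chain: "\<And>q q'. q \<in> C \<Longrightarrow> q' \<in> C \<Longrightarrow> q \<le> q' \<or> q' \<le> q"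
    and below: "\<And>q. q \<in> C \<Longrightarrow> q \<le> p"
  shows "sublinear (\<lambda>x. INF q\<in>C. q x)" and "\<And>q x. q \<in> C \<Longrightarrow> (INF q\<in>C. q x) \<le> q x"
proof -
  let ?m = "\<lambda>x. INF q\<in>C. q x"
  have "- p (- x) \<le> q x" if "q \<in> C" for q x
    using sublinear_uminus_ge[OF sub[OF that], of x] below[OF that]
    by (smt (verit) le_funD)
  then have bdd: "bdd_below ((\<lambda>q. q x) ` C)" for x
    by (intro bdd_belowI2)
  show m_le: "?m x \<le> q x" if "q \<in> C" for q x
    using that by (intro cINF_lower[OF bdd])
  have m_ge: "z \<le> ?m x" if "\<And>q. q \<in> C \<Longrightarrow> z \<le> q x" for z x
    using that \<open>C \<noteq> {}\<close> by (intro cINF_greatest)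
  show "sublinear ?m"
  proof (rule sublinearI)
    fix x y
    have "?m (x + y) - q x \<le> q' y" if q: "q \<in> C" "q' \<in> C" for q q'
    proof -
      obtain s where s: "s \<in> C" "s \<le> q" "s \<le> q'"
        using chain[OF q] q by blast
      then have "?m (x + y) \<le> s x + s y"
        using m_le[OF s(1), of "x + y"] sublinear_add[OF sub[OF s(1)], of x y] by simp
      then show ?thesis
        using le_funD[OF s(2), of x] le_funD[OF s(3), of y] by simp
    qed
    then have "?m (x + y) - q x \<le> ?m y" if "q \<in> C" for q
      using that by (intro m_ge) auto
    then have "?m (x + y) - ?m y \<le> ?m x"
      by (intro m_ge) (force simp: algebra_simps)
    then show "?m (x + y) \<le> ?m x + ?m y" by simp
  next
    fix c :: real and x assume "c > 0"
    have "?m (c *\<^sub>R x) / c \<le> ?m x"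
    proof (rule m_ge)
      fix q assume "q \<in> C"
      then show "?m (c *\<^sub>R x) / c \<le> q x"
        using m_le[of q "c *\<^sub>R x"] sublinear_scaleR[OF sub, of q c x] \<open>c > 0\<close>
        by (simp add: field_simps)
    qed
    then show "?m (c *\<^sub>R x) \<le> c * ?m x"
      using \<open>c > 0\<close> by (simp add: field_simps)
  next
    show "?m 0 = 0"
      using \<open>C \<noteq> {}\<close> by (simp add: sublinear_0[OF sub])
  qed
qed

text \<open>A minimal sublinear functional is odd, since otherwise \<open>sublinear_below\<close> gives a smaller one.\<close>

lemma linear_below_sublinear:
  assumes p: "sublinear p"
  obtains f where "linear f" "\<And>x. f x \<le> p x"
proof -
  define S where "S = {q. sublinear q \<and> q \<le> p}"
  \<comment> \<open>Zorn's lemma is applied to the reversed order, so upper bounds of chains are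
    pointwise infima and the maximal element is a minimal functional. The empty chain is bounded by
    \<open>p\<close>.\<close>
  have "\<exists>m\<in>S. \<forall>q\<in>S. q \<le> m \<longrightarrow> q = m"
  proof (rule predicate_Zorn)
    show "partial_order_on S (relation_of (\<lambda>x y. y \<le> x) S)"
      by (rule partial_order_on_relation_ofI) auto
    fix C assume "C \<in> Chains (relation_of (\<lambda>x y. y \<le> x) S)"
    then have C: "C \<subseteq> S" "\<And>q q'. q \<in> C \<Longrightarrow> q' \<in> C \<Longrightarrow> q \<le> q' \<or> q' \<le> q"
      unfolding Chains_def relation_of_def by blast+
    show "\<exists>u\<in>S. \<forall>q\<in>C. u \<le> q"
    proof (cases "C = {}")
      case True
      then show ?thesis using p by (auto simp: S_def)
    next
      case False
      then obtain q where q: "q \<in> C" by blast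
      let ?m = "\<lambda>x. INF q\<in>C. q x"
      have "sublinear ?m" and m_le: "\<And>q. q \<in> C \<Longrightarrow> ?m \<le> q"
        using sublinear_INF_chain[OF False, of p] C by (auto simp: S_def le_fun_def)
      moreover have "?m \<le> p"
        using m_le[OF q] q C(1) by (auto simp: S_def intro: order_trans)
      ultimately show ?thesis
        by (auto simp: S_def)
    qed
  qed
  then obtain f where f: "sublinear f" "f \<le> p"
    and min: "\<And>q. sublinear q \<Longrightarrow> q \<le> f \<Longrightarrow> q = f"
    unfolding S_def by (auto intro: order_trans)
  have "f (- y) = - f y" for y
  proof -
    obtain r where r: "sublinear r" "\<And>x. r x \<le> f x" "r (- y) \<le> - f y"
      using sublinear_below[OF f(1)] by blast
    then have "r = f"
      by (intro min) (auto simp: le_fun_def)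
    then show ?thesis
      using r(3) sublinear_uminus_ge[OF f(1), of y] by simp
  qed
  then have "linear f"
    using f(1) by (rule sublinear_odd_imp_linear[rotated])
  then show ?thesis
    using that f(2) by (simp add: le_fun_def)
qed

text \<open>Dominating \<open>f\<close> by the functional of \<open>sublinear_below\<close> instead
  of \<open>q\<close> forces \<open>f (- y) \<le> - q y\<close>, which is the missing half of
  equality at \<open>y\<close>.\<close>

lemma sublinear_support:
  assumes "sublinear q"
  obtains f where "linear f" "\<And>x. f x \<le> q x" "f y = q y"
proof -
  obtain r where r: "sublinear r" "\<And>x. r x \<le> q x" "r (- y) \<le> - q y"
    using sublinear_below[OF assms] by blast
  obtain f where f: "linear f" "\<And>x. f x \<le> r x"
    using linear_below_sublinear[OF r(1)] by blast
  show ?thesis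
  proof
    show le: "f x \<le> q x" for x
      using f(2) r(2) by (rule order_trans)
    have "- f y \<le> - q y"
      using f(2)[of "- y"] r(3) linear_neg[OF f(1), of y] by simp
    then show "f y = q y"
      using le[of y] by simp
  qed (rule f(1))
qed

text \<open>\<open>g\<close> is the Minkowski gauge of \<open>A\<close>. A linear functional
  supporting it at \<open>x\<^sub>0\<close> separates, because the gauge is at most 1 on
  \<open>A\<close> and at least 1 at a point outside \<open>A\<close>.\<close>

lemma linear_functional_separating_point:
  assumes "convex A" and absorb: "\<And>x. \<exists>t>0. (1/t) *\<^sub>R x \<in> A" and "x\<^sub>0 \<notin> A"
  obtains f :: "'a::real_vector \<Rightarrow> real" where "linear f" "\<And>x. x \<in> A \<Longrightarrow> f x \<le> 1" "1 \<le> f x\<^sub>0"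
proof -
  define G where "G x = {t::real. t > 0 \<and> (1/t) *\<^sub>R x \<in> A}" for x
  define g where "g x = Inf (G x)" for x
  have "0 \<in> A" using absorb[of 0] by simp
  have bdd: "bdd_below (G x)" for x
    by (rule bdd_belowI[of _ 0]) (auto simp: G_def)
  have ne: "G x \<noteq> {}" for x
    using absorb[of x] by (auto simp: G_def)
  have g_le: "g x \<le> t" if "t \<in> G x" for x t
    unfolding g_def using that bdd by (rule cInf_lower)
  have g_ge: "z \<le> g x" if "\<And>t. t \<in> G x \<Longrightarrow> z \<le> t" for z x
    unfolding g_def using ne that by (rule cInf_greatest)
  have "sublinear g"
  proof (rule sublinearI)
    fix x y
    have "g (x + y) - s \<le> t" if s: "s \<in> G x" and t: "t \<in> G y" for s t
    proof -
      have pos: "s > 0" "t > 0" using s t by (auto simp: G_def)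
      \<comment> \<open>These weights turn the two members of \<open>A\<close> into
        \<open>(1 / (s + t)) *\<^sub>R (x + y)\<close>.\<close>
      have "(s / (s + t)) *\<^sub>R (1/s) *\<^sub>R x + (t / (s + t)) *\<^sub>R (1/t) *\<^sub>R y \<in> A"
        using s t pos by (intro convexD[OF \<open>convex A\<close>]) (auto simp: G_def add_divide_distrib[symmetric])
      then have "(1 / (s + t)) *\<^sub>R (x + y) \<in> A"
        using pos by (simp add: scaleR_add_right)
      then show ?thesis
        using g_le[of "s + t" "x + y"] pos by (simp add: G_def)
    qed
    then have "g (x + y) - s \<le> g y" if "s \<in> G x" for s
      using that by (intro g_ge) auto
    then have "g (x + y) - g y \<le> g x"
      by (intro g_ge) (force simp: algebra_simps)
    then show "g (x + y) \<le> g x + g y" by simp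
  next
    fix c :: real and x assume "c > 0"
    have "g (c *\<^sub>R x) / c \<le> g x"
    proof (rule g_ge)
      fix t assume "t \<in> G x"
      then have "c * t \<in> G (c *\<^sub>R x)"
        using \<open>c > 0\<close> by (simp add: G_def)
      then show "g (c *\<^sub>R x) / c \<le> t"
        using g_le \<open>c > 0\<close> by (simp add: field_simps)
    qed
    then show "g (c *\<^sub>R x) \<le> c * g x"
      using \<open>c > 0\<close> by (simp add: field_simps)
  next
    have "g 0 \<le> e" if "e > 0" for e
      using \<open>0 \<in> A\<close> that by (intro g_le) (simp add: G_def)
    then have "g 0 \<le> 0"
      by (rule field_le_epsilon[of _ 0, simplified])
    moreover have "0 \<le> g 0"
      by (rule g_ge) (simp add: G_def)
    ultimately show "g 0 = 0" by simp
  qed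
  then obtain f where f: "linear f" "\<And>x. f x \<le> g x" "f x\<^sub>0 = g x\<^sub>0"
    using sublinear_support by blast
  have "f x \<le> 1" if "x \<in> A" for x
    using f(2)[of x] g_le[of 1 x] that by (simp add: G_def)
  moreover have "1 \<le> g x\<^sub>0"
  proof (rule g_ge, rule ccontr)
    \<comment> \<open>For \<open>t < 1\<close> the point \<open>x\<^sub>0\<close> would be a convex
      combination of \<open>(1/t) *\<^sub>R x\<^sub>0\<close> and \<open>0\<close>, hence in
      \<open>A\<close>.\<close>
    fix t assume t: "t \<in> G x\<^sub>0" "\<not> 1 \<le> t"
    then have "t *\<^sub>R (1/t) *\<^sub>R x\<^sub>0 + (1 - t) *\<^sub>R 0 \<in> A"
      using \<open>0 \<in> A\<close> by (intro convexD[OF \<open>convex A\<close>]) (auto simp: G_def)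
    then show False
      using t \<open>x\<^sub>0 \<notin> A\<close> by (simp add: G_def)
  qed
  ultimately show ?thesis
    using that f(1,3) by simp
qed

section \<open>Continuity of scalar multiplication and of linear functionals\<close>

lemma tendsto_scaleR_locally_convex:
  fixes g :: "'b \<Rightarrow> 'a::locally_convex"
  assumes "(f \<longlongrightarrow> a) F" "(g \<longlongrightarrow> x) F"
  shows "((\<lambda>i. f i *\<^sub>R g i) \<longlongrightarrow> a *\<^sub>R x) F"
  using filterlim_compose[OF tendsto_scaleR_Pair filterlim_Pair[OF assms]] by simp

lemma nbhd_0_absorbs_point:
  fixes U :: "'a::locally_convex set"
  assumes "open U" "0 \<in> U"
  obtains r where "r > 0" "\<And>s. \<bar>s\<bar> \<ge> r \<Longrightarrow> (1/s) *\<^sub>R x \<in> U"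
proof -
  have "((\<lambda>t. t *\<^sub>R x) \<longlongrightarrow> 0 *\<^sub>R x) (nhds (0::real))"
    by (intro tendsto_scaleR_locally_convex) (auto simp: filterlim_ident)
  then have "eventually (\<lambda>t. t *\<^sub>R x \<in> U) (nhds (0::real))"
    using assms by (auto dest: topological_tendstoD)
  then obtain d where d: "d > 0" "\<And>t. \<bar>t\<bar> < d \<Longrightarrow> t *\<^sub>R x \<in> U"
    by (auto simp: eventually_nhds_metric)
  have "(1/s) *\<^sub>R x \<in> U" if "\<bar>s\<bar> \<ge> 2 / d" for s
  proof (rule d(2))
    have "\<bar>s\<bar> > 1 / d"
      using that d(1) by (smt (verit) divide_strict_right_mono)
    then show "\<bar>1 / s\<bar> < d"
      using d(1) by (cases "s = 0") (auto simp: field_simps)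
  qed
  then show ?thesis
    using d(1) by (intro that[of "2 / d"]) auto
qed

lemma tvs_bounded_singleton: "tvs_bounded euclidean {x :: 'a::locally_convex}"
  unfolding tvs_bounded_def
proof (intro allI impI)
  fix U :: "'a set" assume "nbhd_of_0 euclidean U"
  then obtain V where V: "open V" "0 \<in> V" "V \<subseteq> U"
    by (auto simp: nbhd_of_0_def)
  obtain r where r: "r > 0" "\<And>s. \<bar>s\<bar> \<ge> r \<Longrightarrow> (1/s) *\<^sub>R x \<in> V"
    using nbhd_0_absorbs_point[OF V(1,2)] by blast
  have "x \<in> (\<lambda>x. s *\<^sub>R x) ` U" if "\<bar>s\<bar> \<ge> r" for s
    using r(1) r(2)[OF that] V(3) that by (intro image_eqI[of _ _ "(1/s) *\<^sub>R x"]) auto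
  then show "absorbs U {x}"
    unfolding absorbs_def using r(1) by auto
qed

lemma continuous_on_linear_functional:
  fixes f :: "'a::locally_convex \<Rightarrow> real"
  assumes "linear f" "open V" "0 \<in> V" and le: "\<And>x. x \<in> V \<Longrightarrow> f x \<le> 1"
  shows "continuous_on UNIV f"
proof -
  have "(f \<longlongrightarrow> f x) (at x)" for x
  proof (rule tendstoI)
    fix e :: real assume "e > 0"
    have near: "eventually (\<lambda>y. c *\<^sub>R (y - x) \<in> V) (at x)" for c
    proof -
      have "((\<lambda>y. c *\<^sub>R (y - x)) \<longlongrightarrow> c *\<^sub>R (x - x)) (at x)"
        by (intro tendsto_scaleR_locally_convex tendsto_intros)
      then show ?thesis
        using assms(2,3) by (auto dest: topological_tendstoD)
    qed
    \<comment> \<open>\<open>V\<close> need not be symmetric, so both signs are required to bound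
      the absolute value, here by \<open>e / 2\<close>.\<close>
    have "eventually (\<lambda>y. (2/e) *\<^sub>R (y - x) \<in> V \<and> (- 2/e) *\<^sub>R (y - x) \<in> V) (at x)"
      by (intro eventually_conj near)
    then show "eventually (\<lambda>y. dist (f y) (f x) < e) (at x)"
    proof (rule eventually_mono)
      fix y assume "(2/e) *\<^sub>R (y - x) \<in> V \<and> (- 2/e) *\<^sub>R (y - x) \<in> V"
      then have "(2/e) * (f y - f x) \<le> 1" "(- 2/e) * (f y - f x) \<le> 1"
        using le[of "(2/e) *\<^sub>R (y - x)"] le[of "(- 2/e) *\<^sub>R (y - x)"]
          linear_scale[OF assms(1)] linear_diff[OF assms(1)]
        by (metis real_scaleR_def)+
      then have "\<bar>f y - f x\<bar> \<le> e / 2"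
        using \<open>e > 0\<close> by (simp add: field_simps abs_if)
      then show "dist (f y) (f x) < e"
        using \<open>e > 0\<close> by (simp add: dist_real_def)
    qed
  qed
  then show ?thesis
    by (simp add: continuous_on_def)
qed

section \<open>Separation by continuous functionals\<close>

lemma linear_dual_apply: "linear (dual_apply f)"
  and continuous_dual_apply: "continuous_on UNIV (dual_apply f)"
  using dual_apply[of f] by auto

text \<open>For a convex neighbourhood \<open>V\<close> of 0 such that \<open>x\<^sub>0 - V\<close>
  misses \<open>closure S\<close>, the set \<open>A = V + S\<close> is convex, absorbs points and
  misses \<open>x\<^sub>0\<close>. A functional bounded above on \<open>A\<close> is continuous
  because it is bounded above on \<open>V\<close>, and vanishes on \<open>S\<close> because
  \<open>S\<close> is closed under scaling.\<close>

lemma dual_apply_vanishing_on_subspace: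
  fixes S :: "'a::locally_convex set"
  assumes "subspace S" "x\<^sub>0 \<notin> closure S"
  obtains f where "\<And>x. x \<in> S \<Longrightarrow> dual_apply f x = 0" "dual_apply f x\<^sub>0 \<noteq> 0"
proof -
  have "open ((\<lambda>v. x\<^sub>0 - v) -` (- closure S))"
    by (intro open_vimage continuous_intros) auto
  moreover have "0 \<in> (\<lambda>v. x\<^sub>0 - v) -` (- closure S)"
    using assms(2) by simp
  ultimately obtain V where V: "open V" "0 \<in> V" "V \<subseteq> (\<lambda>v. x\<^sub>0 - v) -` (- closure S)"
    and "\<forall>x\<in>V. \<forall>y\<in>V. \<forall>u\<ge>0. \<forall>v\<ge>0. u + v = 1 \<longrightarrow> u *\<^sub>R x + v *\<^sub>R y \<in> V"
    using locally_convex_at_0 by metis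
  then have "convex V" by (auto simp: convex_def)
  define A where "A = (\<Union>v\<in>V. \<Union>s\<in>S. {v + s})"
  have subA: "v + s \<in> A" if "v \<in> V" "s \<in> S" for v s
    using that by (auto simp: A_def)
  have "0 \<in> S" using assms(1) by (rule subspace_0)
  have "convex A"
    unfolding A_def using \<open>convex V\<close> subspace_imp_convex[OF assms(1)] by (rule convex_sums)
  moreover have "\<exists>t>0. (1/t) *\<^sub>R x \<in> A" for x
  proof -
    obtain r where "r > 0" "\<And>s. \<bar>s\<bar> \<ge> r \<Longrightarrow> (1/s) *\<^sub>R x \<in> V"
      using nbhd_0_absorbs_point[OF V(1,2)] by blast
    then show ?thesis
      using subA[OF _ \<open>0 \<in> S\<close>, of "(1/r) *\<^sub>R x"] by auto
  qed
  moreover have "x\<^sub>0 \<notin> A"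
  proof
    assume "x\<^sub>0 \<in> A"
    then obtain v s where "v \<in> V" "s \<in> S" "x\<^sub>0 - v = s" by (auto simp: A_def)
    then show False using V(3) closure_subset by fastforce
  qed
  ultimately obtain f :: "'a \<Rightarrow> real"
    where f: "linear f" "\<And>x. x \<in> A \<Longrightarrow> f x \<le> 1" "1 \<le> f x\<^sub>0"
    by (rule linear_functional_separating_point) (rule that)
  have "f x \<le> 1" if "x \<in> V" for x
    using f(2) subA[OF that \<open>0 \<in> S\<close>] by simp
  then have "continuous_on UNIV f"
    using continuous_on_linear_functional[OF f(1) V(1,2)] by blast
  then have apply_f: "dual_apply (Abs_cdual f) = f"
    using f(1) by (simp add: Abs_cdual_inverse)
  have "f x = 0" if "x \<in> S" for x
  proof (rule ccontr)
    assume "f x \<noteq> 0"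
    \<comment> \<open>This multiple of \<open>x\<close> has value 2, above the bound 1 on
      \<open>A\<close>.\<close>
    have "(2 / f x) *\<^sub>R x \<in> A"
      using subA[OF \<open>0 \<in> V\<close>] subspace_scale[OF assms(1) that] by simp
    then show False
      using f(2) linear_scale[OF f(1), of "2 / f x" x] \<open>f x \<noteq> 0\<close> by fastforce
  qed
  then show ?thesis
    using that[of "Abs_cdual f"] f(3) apply_f by simp
qed

section \<open>Bounded sets in the dual\<close>

lemma dual_apply_add [simp]: "dual_apply (f + g) x = dual_apply f x + dual_apply g x"
  and dual_apply_uminus [simp]: "dual_apply (- f) x = - dual_apply f x"
  and dual_apply_scaleR [simp]: "dual_apply (c *\<^sub>R f) x = c * dual_apply f x"
  and dual_apply_zero [simp]: "dual_apply 0 x = 0"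
  by (transfer, simp)+

lemma dual_apply_point_add: "dual_apply f (x + y) = dual_apply f x + dual_apply f y"
  and dual_apply_point_diff: "dual_apply f (x - y) = dual_apply f x - dual_apply f y"
  and dual_apply_point_scaleR: "dual_apply f (c *\<^sub>R x) = c * dual_apply f x"
  and dual_apply_point_sum: "dual_apply f (sum h I) = (\<Sum>i\<in>I. dual_apply f (h i))"
  using linear_dual_apply[of f] by (simp_all add: linear_add linear_diff linear_scale linear_sum)

section \<open>Polars and equicontinuity\<close>

lemma tvs_bounded_subset: "tvs_bounded T S \<Longrightarrow> S' \<subseteq> S \<Longrightarrow> tvs_bounded T S'"
  unfolding tvs_bounded_def absorbs_def by (meson order_trans)

lemma nbhd_of_0_strong_dual_polar:
  assumes "tvs_bounded euclidean B"
  shows "nbhd_of_0 strong_dual {g. \<forall>x\<in>B. \<bar>dual_apply g x\<bar> \<le> 1}"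
proof -
  \<comment> \<open>One bound \<open>d < 1\<close> for the whole of \<open>B\<close> leaves a
    uniform margin \<open>1 - d\<close>; pointwise strict inequality would not make the set
    open.\<close>
  let ?U = "{g. \<exists>d<1. \<forall>x\<in>B. \<bar>dual_apply g x\<bar> \<le> d}"
  have "openin strong_dual ?U"
    unfolding openin_strong_dual
  proof
    fix g assume "g \<in> ?U"
    then obtain d where d: "d < 1" "\<forall>x\<in>B. \<bar>dual_apply g x\<bar> \<le> d" by blast
    have "{h. \<forall>x\<in>B. \<bar>dual_apply h x - dual_apply g x\<bar> < (1 - d) / 2} \<subseteq> ?U"
    proof
      fix h assume h: "h \<in> {h. \<forall>x\<in>B. \<bar>dual_apply h x - dual_apply g x\<bar> < (1 - d) / 2}"
      have "\<bar>dual_apply h x\<bar> \<le> (1 + d) / 2" if "x \<in> B" for x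
      proof -
        have "\<bar>dual_apply h x - dual_apply g x\<bar> < (1 - d) / 2" "\<bar>dual_apply g x\<bar> \<le> d"
          using h d(2) that by auto
        then show ?thesis by argo
      qed
      then show "h \<in> ?U" using d(1) by (intro CollectI exI[of _ "(1 + d) / 2"]) auto
    qed
    then show "\<exists>B' e. tvs_bounded euclidean B' \<and> e > 0 \<and>
        {h. \<forall>x\<in>B'. \<bar>dual_apply h x - dual_apply g x\<bar> < e} \<subseteq> ?U"
      using assms d(1) by (intro exI[of _ B] exI[of _ "(1 - d) / 2"]) auto
  qed
  moreover have "0 \<in> ?U" by (auto intro: exI[of _ 0])
  moreover have "?U \<subseteq> {g. \<forall>x\<in>B. \<bar>dual_apply g x\<bar> \<le> 1}" by force
  ultimately show ?thesis
    unfolding nbhd_of_0_def by blast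
qed

lemma strong_dual_bounded_uniform:
  assumes "tvs_bounded strong_dual M" "tvs_bounded euclidean B"
  obtains r where "r > 0" "\<And>f x. f \<in> M \<Longrightarrow> x \<in> B \<Longrightarrow> \<bar>dual_apply f x\<bar> \<le> r"
proof -
  let ?P = "{g. \<forall>x\<in>B. \<bar>dual_apply g x\<bar> \<le> 1}"
  have "absorbs ?P M"
    using assms nbhd_of_0_strong_dual_polar by (auto simp: tvs_bounded_def)
  then obtain r where "r > 0" and abs: "\<forall>s. r \<le> \<bar>s\<bar> \<longrightarrow> M \<subseteq> (\<lambda>f. s *\<^sub>R f) ` ?P"
    unfolding absorbs_def by blast
  have r: "M \<subseteq> (\<lambda>f. r *\<^sub>R f) ` ?P"
    using abs[rule_format, of r] by simp
  have "\<bar>dual_apply f x\<bar> \<le> r" if "f \<in> M" "x \<in> B" for f x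
  proof -
    obtain g where "g \<in> ?P" "f = r *\<^sub>R g" using r \<open>f \<in> M\<close> by blast
    then show ?thesis
      using \<open>x \<in> B\<close> \<open>r > 0\<close> by (simp add: abs_mult)
  qed
  then show ?thesis using that \<open>r > 0\<close> by blast
qed

text \<open>The polar of \<open>M\<close> in \<open>E\<close> is a barrel. It absorbs every bounded
  set because \<open>M\<close> is uniformly bounded there, and it is absorbent because singletons
  are bounded; infrabarreledness then makes it a neighbourhood of 0.\<close>

lemma infrabarreled_equicontinuous:
  fixes M :: "'a::locally_convex cdual set"
  assumes "infrabarreled TYPE('a)" and M: "tvs_bounded strong_dual M"
  obtains U where "open U" "0 \<in> U" "\<And>f x. f \<in> M \<Longrightarrow> x \<in> U \<Longrightarrow> \<bar>dual_apply f x\<bar> \<le> 1"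
proof -
  let ?P = "{x. \<forall>f\<in>M. \<bar>dual_apply f x\<bar> \<le> 1}"
  have absorbs: "absorbs ?P S" if S: "tvs_bounded euclidean S" for S
  proof -
    obtain r where r: "r > 0" "\<And>f x. f \<in> M \<Longrightarrow> x \<in> S \<Longrightarrow> \<bar>dual_apply f x\<bar> \<le> r"
      using strong_dual_bounded_uniform[OF M S] by blast
    have "x \<in> (\<lambda>x. s *\<^sub>R x) ` ?P" if "\<bar>s\<bar> \<ge> r" "x \<in> S" for s x
    proof (rule image_eqI)
      show "x = s *\<^sub>R (1/s) *\<^sub>R x" using r(1) that(1) by auto
      have "\<bar>dual_apply f x\<bar> / \<bar>s\<bar> \<le> 1" if "f \<in> M" for f
        using r(1) r(2)[OF that \<open>x \<in> S\<close>] \<open>\<bar>s\<bar> \<ge> r\<close> by (simp add: divide_le_eq_1)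
      then show "(1/s) *\<^sub>R x \<in> ?P"
        by (simp add: dual_apply_point_scaleR abs_mult)
    qed
    then show ?thesis
      unfolding absorbs_def using r(1) by blast
  qed
  have "closed ?P"
  proof -
    have "?P = (\<Inter>f\<in>M. {x. \<bar>dual_apply f x\<bar> \<le> 1})" by auto
    also have "closed \<dots>"
      by (intro closed_INT ballI closed_Collect_le continuous_intros
          continuous_on_subset[OF continuous_dual_apply]) auto
    finally show ?thesis .
  qed
  moreover have "convex ?P"
  proof (rule convexI)
    fix x y and u v :: real
    assume xy: "x \<in> ?P" "y \<in> ?P" and uv: "0 \<le> u" "0 \<le> v" "u + v = 1"
    have "\<bar>u * dual_apply f x + v * dual_apply f y\<bar> \<le> 1" if "f \<in> M" for f
    proof -
      have "\<bar>u * dual_apply f x + v * dual_apply f y\<bar> \<le> u * \<bar>dual_apply f x\<bar> + v * \<bar>dual_apply f y\<bar>"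
        using abs_triangle_ineq[of "u * dual_apply f x" "v * dual_apply f y"] uv
        by (simp add: abs_mult)
      also have "\<dots> \<le> 1"
        using xy that uv by (intro convex_bound_le) auto
      finally show ?thesis .
    qed
    then show "u *\<^sub>R x + v *\<^sub>R y \<in> ?P"
      by (simp add: dual_apply_point_add dual_apply_point_scaleR)
  qed
  moreover have "balanced ?P"
    unfolding balanced_def
    by (auto simp: dual_apply_point_scaleR abs_mult intro!: mult_le_one)
  moreover have "absorbent ?P"
    unfolding absorbent_def using absorbs tvs_bounded_singleton by blast
  ultimately have "nbhd_of_0 euclidean ?P"
    using assms(1) absorbs unfolding infrabarreled_def barrel_def by blast
  then obtain U where "open U" "0 \<in> U" "U \<subseteq> ?P"
    unfolding nbhd_of_0_def by auto
  then show ?thesis using that by blast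
qed

text \<open>The factor \<open>c\<close> lets one fixed neighbourhood, such as one given by
  equicontinuity, yield any desired accuracy.\<close>

lemma dense_approx:
  fixes D :: "'a::locally_convex set"
  assumes "closure D = UNIV" "open U" "0 \<in> U"
  obtains y where "y \<in> D" "c *\<^sub>R (x - y) \<in> U"
proof -
  let ?V = "(\<lambda>y. c *\<^sub>R (x - y)) -` U"
  have "continuous_on UNIV (\<lambda>y. c *\<^sub>R (x - y))"
    unfolding continuous_on_def by (intro ballI tendsto_scaleR_locally_convex tendsto_intros)
  then have "open ?V" using assms(2) by (rule open_vimage[rotated])
  moreover have "x \<in> ?V" using assms(3) by simp
  ultimately have "?V \<inter> D \<noteq> {}"
    using open_Int_closure_eq_empty[of ?V D] assms(1) by blast
  then show ?thesis using that by blast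
qed

section \<open>Weak-star neighbourhoods of 0\<close>

lemma openin_weak_star_less: "openin weak_star {f. dual_apply f x < l}"
proof -
  have "openin (product_topology (\<lambda>_. euclideanreal) UNIV) {h \<in> UNIV. h x \<in> {..<l}}"
    using openin_continuous_map_preimage[OF continuous_map_product_projection[of x UNIV "\<lambda>_. euclideanreal"], of "{..<l}"]
    by simp
  then show ?thesis
    unfolding weak_star_def openin_pullback_topology by (intro exI conjI) auto
qed

text \<open>A basic open set of the product topology restricts only finitely many coordinates, and
  the least of their radii serves for all.\<close>

lemma nbhd_of_0_weak_starE:
  assumes "nbhd_of_0 weak_star W"
  obtains X e where "finite X" "e > 0" "{f. \<forall>x\<in>X. \<bar>dual_apply f x\<bar> < e} \<subseteq> W"
proof -
  obtain T where T: "openin (product_topology (\<lambda>_. euclideanreal) UNIV) T" "dual_apply 0 \<in> T"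
    "dual_apply -` T \<subseteq> W"
    using assms unfolding nbhd_of_0_def weak_star_def openin_pullback_topology by auto
  from T(1)[unfolded openin_product_topology_alt, rule_format, OF T(2)]
  obtain U where U: "finite {x. U x \<noteq> UNIV}" "\<And>x. open (U x)" "dual_apply 0 \<in> Pi\<^sub>E UNIV U" "Pi\<^sub>E UNIV U \<subseteq> T"
    by auto
  let ?X = "{x. U x \<noteq> UNIV}"
  have "\<exists>e>0. ball 0 e \<subseteq> U x" for x
    using U(2,3) open_contains_ball[of "U x"] by (auto simp: PiE_iff)
  then obtain e where e: "\<And>x. e x > 0" "\<And>x. ball 0 (e x) \<subseteq> U x" by metis
  \<comment> \<open>Inserting 1 keeps the minimum meaningful when no coordinate is
    restricted.\<close>
  let ?d = "Min (insert 1 (e ` ?X))"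
  show ?thesis
  proof
    show "finite ?X" by (rule U(1))
    show "?d > 0" using U(1) e(1) by auto
    show "{f. \<forall>x\<in>?X. \<bar>dual_apply f x\<bar> < ?d} \<subseteq> W"
    proof
      fix f assume f: "f \<in> {f. \<forall>x\<in>?X. \<bar>dual_apply f x\<bar> < ?d}"
      have "dual_apply f x \<in> U x" for x
      proof (cases "x \<in> ?X")
        case True
        then have "\<bar>dual_apply f x\<bar> < e x" using f U(1) by auto
        then show ?thesis using e(2)[of x] by (auto simp: dist_real_def)
      qed auto
      then have "dual_apply f \<in> Pi\<^sub>E UNIV U" by (auto simp: PiE_iff)
      then show "f \<in> W" using U(4) T(3) by auto
    qed
  qed
qed

section \<open>Cones\<close>

text \<open>Induction over linear combinations: a term with negative coefficient is moved, with its
  sign changed, to the subtracted element.\<close>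

lemma span_convex_cone_diff:
  assumes K: "convex_cone K" and "x \<in> span K"
  obtains a b where "a \<in> K" "b \<in> K" "x = a - b"
proof -
  have "0 \<in> K" using K by (rule convex_cone_contains_0)
  have "\<exists>a\<in>K. \<exists>b\<in>K. x = a - b"
    using \<open>x \<in> span K\<close>
  proof (induction rule: span_induct_alt)
    case base
    then show ?case using \<open>0 \<in> K\<close> by force
  next
    case (step c k y)
    then obtain a b where ab: "a \<in> K" "b \<in> K" "y = a - b" by blast
    show ?case
    proof (cases "c \<ge> 0")
      case True
      then have "c *\<^sub>R k + a \<in> K"
        using K step(1) ab by (intro convex_cone_add convex_cone_scaleR)
      then show ?thesis using ab by (intro bexI[of _ "c *\<^sub>R k + a"] bexI[of _ b]) auto
    next
      case False
      then have "(- c) *\<^sub>R k + b \<in> K"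
        using K step(1) ab by (intro convex_cone_add convex_cone_scaleR) auto
      then show ?thesis using ab by (intro bexI[of _ a] bexI[of _ "(- c) *\<^sub>R k + b"]) auto
    qed
  qed
  then show ?thesis using that by blast
qed

lemma dual_cone_nonneg: "f \<in> dual_cone K \<Longrightarrow> k \<in> K \<Longrightarrow> 0 \<le> dual_apply f k"
  by (simp add: dual_cone_def)

lemma dual_cone_scaleR: "f \<in> dual_cone K \<Longrightarrow> 0 \<le> c \<Longrightarrow> c *\<^sub>R f \<in> dual_cone K"
  by (simp add: dual_cone_def)

section \<open>Density of the span\<close>

lemma closure_span_eq_UNIV:
  fixes K :: "'a::locally_convex set"
  assumes "\<And>f. (\<And>k. k \<in> K \<Longrightarrow> dual_apply f k = 0) \<Longrightarrow> f = 0"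
  shows "closure (span K) = UNIV"
proof (rule ccontr)
  assume "closure (span K) \<noteq> UNIV"
  then obtain x where "x \<notin> closure (span K)" by blast
  then obtain f where "\<And>x. x \<in> span K \<Longrightarrow> dual_apply f x = 0" "dual_apply f x \<noteq> 0"
    using dual_apply_vanishing_on_subspace[OF subspace_span] by blast
  then show False using assms[of f] span_base by fastforce
qed

lemma span_dense_of_bounded_slice:
  assumes bdd: "tvs_bounded strong_dual ({f. dual_apply f k \<le> l} \<inter> dual_cone K)"
    and "k \<in> K" "l > 0"
  shows "closure (span K) = UNIV"
proof (rule closure_span_eq_UNIV)
  fix f assume f: "\<And>k. k \<in> K \<Longrightarrow> dual_apply f k = 0"
  have "dual_apply f x = 0" for x
  proof (rule ccontr)
    assume nz: "dual_apply f x \<noteq> 0"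
    obtain r where r: "r > 0" "\<And>g y. g \<in> {f. dual_apply f k \<le> l} \<inter> dual_cone K \<Longrightarrow> y \<in> {x} \<Longrightarrow> \<bar>dual_apply g y\<bar> \<le> r"
      by (rule strong_dual_bounded_uniform[OF bdd tvs_bounded_singleton[of x]]) (rule that)
    \<comment> \<open>Every multiple of \<open>f\<close> vanishes on \<open>K\<close>, so it lies in
      the slice; this one has value \<open>2 * r\<close> at \<open>x\<close>, beyond the bound
      \<open>r\<close>.\<close>
    have "(2 * r / dual_apply f x) *\<^sub>R f \<in> {f. dual_apply f k \<le> l} \<inter> dual_cone K"
      using f assms(2,3) by (simp add: dual_cone_def)
    from r(2)[OF this singletonI] show False using nz r(1) by simp
  qed
  then show "f = 0" by (simp add: dual_apply_inject[symmetric] fun_eq_iff)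
qed

lemma span_dense_of_s_ext:
  assumes "zero_in_s_ext (dual_cone K)"
  shows "closure (span K) = UNIV"
proof (rule closure_span_eq_UNIV)
  fix f assume f: "\<And>k. k \<in> K \<Longrightarrow> dual_apply f k = 0"
  \<comment> \<open>A single index suffices, since both nets are constant, with midpoint 0.\<close>
  let ?I = "{0} :: 'a cdual set set"
  have dir: "directed_by ?I (=)" by (simp add: directed_by_def)
  have "f \<in> dual_cone K" "- f \<in> dual_cone K" using f by (simp_all add: dual_cone_def)
  moreover have "limitin strong_dual (\<lambda>i. (1/2) *\<^sub>R (f + (- f))) 0 (net_filter ?I (=))"
    by (simp add: limitin_const)
  ultimately have "limitin weak_star (\<lambda>i. f) 0 (net_filter ?I (=))"
    using assms[unfolded zero_in_s_ext_def zero_in_s_ext_indexed_def, rule_format,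
        of ?I "(=)" "\<lambda>_. f" "\<lambda>_. - f"] dir by blast
  then have "((\<lambda>i. dual_apply f x) \<longlongrightarrow> 0) (net_filter ?I (=))" for x
    by (simp add: limitin_weak_star)
  \<comment> \<open>Only along a proper filter does a constant net determine its limit.\<close>
  moreover have "net_filter ?I (=) \<noteq> bot"
    unfolding trivial_limit_def eventually_net_filter[OF dir] by simp
  ultimately have "dual_apply f x = 0" for x
    by (simp add: tendsto_const_iff)
  then show "f = 0" by (simp add: dual_apply_inject[symmetric] fun_eq_iff)
qed

section \<open>From a bounded slice to s-extremality\<close>

lemma s_ext_of_bounded_slice:
  fixes K :: "'a::locally_convex set"
  assumes inf: "infrabarreled TYPE('a)" and K: "convex_cone K"
    and bdd: "tvs_bounded strong_dual ({f. dual_apply f k \<le> l} \<inter> dual_cone K)"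
    and k: "k \<in> K" and "l > 0"
  shows "zero_in_s_ext (dual_cone K)"
  unfolding zero_in_s_ext_def zero_in_s_ext_indexed_def
proof (intro allI impI)
  fix I :: "'a cdual set set" and le c c'
  assume *: "directed_by I le \<and> (\<forall>i\<in>I. c i \<in> dual_cone K \<and> c' i \<in> dual_cone K) \<and>
    limitin strong_dual (\<lambda>i. (1/2) *\<^sub>R (c i + c' i)) 0 (net_filter I le)"
  let ?F = "net_filter I le"
  have inC: "eventually (\<lambda>i. c i \<in> dual_cone K \<and> c' i \<in> dual_cone K) ?F"
  proof -
    have dir: "directed_by I le" and C: "\<forall>i\<in>I. c i \<in> dual_cone K \<and> c' i \<in> dual_cone K"
      using * by auto
    then obtain i where "i \<in> I" unfolding directed_by_def by blast
    with C show ?thesis unfolding eventually_net_filter[OF dir] by blast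
  qed
  \<comment> \<open>Singletons are bounded, so strong convergence of the midpoints gives convergence
    at \<open>a\<close>. The factor 2 undoes the midpoint, and \<open>c i\<close> is squeezed
    between 0 and \<open>c i + c' i\<close>.\<close>
  have lim_K: "((\<lambda>i. dual_apply (c i) a) \<longlongrightarrow> 0) ?F" if "a \<in> K" for a
  proof -
    have "uniform_limit {a} (\<lambda>i. dual_apply ((1/2) *\<^sub>R (c i + c' i))) (dual_apply 0) ?F"
      using * tvs_bounded_singleton[of a] unfolding limitin_strong_dual by blast
    then have "((\<lambda>i. 2 * dual_apply ((1/2) *\<^sub>R (c i + c' i)) a) \<longlongrightarrow> 2 * 0) ?F"
      by (intro tendsto_mult_left) (use tendsto_uniform_limitI in fastforce)
    then have "((\<lambda>i. dual_apply (c i) a + dual_apply (c' i) a) \<longlongrightarrow> 0) ?F" by (simp add: add_divide_distrib)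
    moreover have "eventually (\<lambda>i. 0 \<le> dual_apply (c i) a) ?F"
      using inC by (rule eventually_mono) (simp add: dual_cone_nonneg[OF _ that])
    moreover have "eventually (\<lambda>i. dual_apply (c i) a \<le> dual_apply (c i) a + dual_apply (c' i) a) ?F"
      using inC by (rule eventually_mono) (simp add: dual_cone_nonneg[OF _ that])
    ultimately show ?thesis
      by (rule tendsto_sandwich[OF _ _ tendsto_const, rotated 2])
  qed
  obtain U where U: "open U" "0 \<in> U"
    "\<And>f x. f \<in> {f. dual_apply f k \<le> l} \<inter> dual_cone K \<Longrightarrow> x \<in> U \<Longrightarrow> \<bar>dual_apply f x\<bar> \<le> 1"
    by (rule infrabarreled_equicontinuous[OF inf bdd]) (rule that)
  have "eventually (\<lambda>i. dual_apply (c i) k < l) ?F"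
    using lim_K[OF k] \<open>l > 0\<close> by (rule order_tendstoD(2))
  then have slice: "eventually (\<lambda>i. c i \<in> {f. dual_apply f k \<le> l} \<inter> dual_cone K) ?F"
    using inC by eventually_elim auto
  have "((\<lambda>i. dual_apply (c i) x) \<longlongrightarrow> 0) ?F" for x
  proof (rule tendstoI)
    fix e :: real assume "e > 0"
    \<comment> \<open>On the slice, the factor \<open>2/e\<close> makes replacing \<open>x\<close>
      by \<open>y\<close> cost at most \<open>e / 2\<close>; the other half comes from convergence
      at \<open>y\<close>.\<close>
    obtain y where y: "y \<in> span K" "(2/e) *\<^sub>R (x - y) \<in> U"
      using dense_approx[OF span_dense_of_bounded_slice[OF bdd k \<open>l > 0\<close>] U(1,2)] by blast
    obtain a b where ab: "a \<in> K" "b \<in> K" "y = a - b"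
      using span_convex_cone_diff[OF K y(1)] by blast
    have "((\<lambda>i. dual_apply (c i) y) \<longlongrightarrow> 0) ?F"
      using tendsto_diff[OF lim_K[OF ab(1)] lim_K[OF ab(2)]]
      by (simp add: ab(3) dual_apply_point_diff)
    then have "eventually (\<lambda>i. \<bar>dual_apply (c i) y\<bar> < e / 2) ?F"
      using \<open>e > 0\<close> tendstoD[of "\<lambda>i. dual_apply (c i) y" 0 ?F "e / 2"]
      by (simp add: dist_real_def)
    then show "eventually (\<lambda>i. dist (dual_apply (c i) x) 0 < e) ?F"
      using slice
    proof eventually_elim
      case (elim i)
      have "\<bar>dual_apply (c i) ((2/e) *\<^sub>R (x - y))\<bar> \<le> 1"
        using U(3)[OF elim(2) y(2)] .
      then have "\<bar>dual_apply (c i) x - dual_apply (c i) y\<bar> \<le> e / 2"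
        unfolding dual_apply_point_scaleR dual_apply_point_diff abs_mult
        using \<open>e > 0\<close> by (simp add: field_simps)
      then show ?case using elim(1) unfolding dist_real_def by argo
    qed
  qed
  then show "limitin weak_star c 0 ?F"
    by (simp add: limitin_weak_star)
qed

section \<open>From density to a bounded slice\<close>

lemma bounded_slice_of_bPC:
  fixes K :: "'a::locally_convex set"
  assumes inf: "infrabarreled TYPE('a)" and K: "convex_cone K"
    and "zero_in_bPC strong_dual (dual_cone K)" and dense: "closure (span K) = UNIV"
  obtains k l where "k \<in> K" "l > 0"
    "tvs_bounded strong_dual ({f. dual_apply f k \<le> l} \<inter> dual_cone K)"
proof -
  obtain W where W: "nbhd_of_0 weak_star W" "tvs_bounded strong_dual (dual_cone K \<inter> W)"
    using assms(3) by (auto simp: zero_in_bPC_def)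
  obtain X e where X: "finite X" "e > 0" "{f. \<forall>x\<in>X. \<bar>dual_apply f x\<bar> < e} \<subseteq> W"
    using nbhd_of_0_weak_starE[OF W(1)] by blast
  obtain U where U: "open U" "0 \<in> U"
    "\<And>f x. f \<in> dual_cone K \<inter> W \<Longrightarrow> x \<in> U \<Longrightarrow> \<bar>dual_apply f x\<bar> \<le> 1"
    by (rule infrabarreled_equicontinuous[OF inf W(2)]) (rule that)
  \<comment> \<open>The factor \<open>4/e\<close> makes the approximation error at most
    \<open>e / 4\<close> for functionals in \<open>dual_cone K \<inter> W\<close>.\<close>
  have "\<exists>a\<in>K. \<exists>b\<in>K. (4/e) *\<^sub>R (x - (a - b)) \<in> U" for x
    using dense_approx[OF dense U(1,2), of "4/e" x] span_convex_cone_diff[OF K] by metis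
  then obtain a b where ab: "\<And>x. a x \<in> K" "\<And>x. b x \<in> K"
    "\<And>x. (4/e) *\<^sub>R (x - (a x - b x)) \<in> U" by metis
  define k where "k = (\<Sum>x\<in>X. a x + b x)"
  have "k \<in> K"
    unfolding k_def using X(1)
    by (induction X rule: finite_induct)
      (auto intro!: convex_cone_add[OF K] ab convex_cone_contains_0[OF K])
  have le_k: "\<bar>dual_apply f (a x - b x)\<bar> \<le> dual_apply f k" if f: "f \<in> dual_cone K" and "x \<in> X" for f x
  proof -
    have nonneg: "0 \<le> dual_apply f (a x)" "0 \<le> dual_apply f (b x)" for x
      using f ab by (auto intro: dual_cone_nonneg)
    then have "\<bar>dual_apply f (a x - b x)\<bar> \<le> dual_apply f (a x + b x)"
      by (simp add: dual_apply_point_diff dual_apply_point_add abs_le_iff)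
    also have "\<dots> \<le> dual_apply f k"
      unfolding k_def dual_apply_point_sum using X(1) \<open>x \<in> X\<close> nonneg
      by (intro member_le_sum) (auto simp: dual_apply_point_add)
    finally show ?thesis .
  qed
  \<comment> \<open>The level \<open>e/8\<close> is small enough that, with the error
    \<open>e / 4\<close>, the total \<open>3 * e / 8\<close> stays below
    \<open>e / 2\<close>.\<close>
  have "{f. dual_apply f k \<le> e/8} \<inter> dual_cone K \<subseteq> dual_cone K \<inter> W"
  proof
    fix f assume "f \<in> {f. dual_apply f k \<le> e/8} \<inter> dual_cone K"
    then have f: "dual_apply f k \<le> e/8" "f \<in> dual_cone K" by auto
    have "\<bar>dual_apply f x\<bar> < e" if "x \<in> X" for x
    proof -
      \<comment> \<open>The largest value on the finite set \<open>X\<close> is attained at some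
        \<open>z\<close>; rescaling by it controls all of \<open>X\<close> at once.\<close>
      define m where "m = Max ((\<lambda>x. \<bar>dual_apply f x\<bar>) ` X)"
      have le_m: "\<bar>dual_apply f x\<bar> \<le> m" if "x \<in> X" for x
        unfolding m_def using X(1) that by auto
      have "m \<in> (\<lambda>x. \<bar>dual_apply f x\<bar>) ` X"
        unfolding m_def using X(1) that by (intro Max_in) auto
      then obtain z where z: "z \<in> X" "m = \<bar>dual_apply f z\<bar>" by blast
      have "m < e"
      proof (rule ccontr)
        assume "\<not> m < e"
        \<comment> \<open>\<open>f\<close> itself is not yet known to lie in \<open>W\<close>, so
          the equicontinuity bound applies only after scaling. This \<open>t\<close> brings the
          maximum down to exactly \<open>e / 2\<close>, which puts \<open>t *\<^sub>R f\<close> in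
          \<open>W\<close> and contradicts the bound \<open>3 * e / 8\<close> at
          \<open>z\<close>.\<close>
        define t where "t = e / (2 * m)"
        have t: "0 < t" "t < 1" "t * m = e / 2"
          using \<open>\<not> m < e\<close> \<open>e > 0\<close> by (auto simp: t_def)
        have "\<bar>dual_apply (t *\<^sub>R f) x\<bar> < e" if "x \<in> X" for x
        proof -
          have "\<bar>dual_apply (t *\<^sub>R f) x\<bar> \<le> t * m"
            using le_m[OF that] t(1) by (simp add: abs_mult)
          then show ?thesis using t(3) \<open>e > 0\<close> by simp
        qed
        then have "t *\<^sub>R f \<in> dual_cone K \<inter> W"
          using X(3) dual_cone_scaleR[OF f(2)] t(1) by auto
        then have "\<bar>dual_apply (t *\<^sub>R f) ((4/e) *\<^sub>R (z - (a z - b z)))\<bar> \<le> 1"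
          using ab(3) by (rule U(3))
        then have "(4/e) * (t * \<bar>dual_apply f z - dual_apply f (a z - b z)\<bar>) \<le> 1"
          unfolding dual_apply_scaleR dual_apply_point_scaleR dual_apply_point_diff[of f z] abs_mult
          using t(1) \<open>e > 0\<close> by (simp add: mult.left_commute)
        then have 1: "t * \<bar>dual_apply f z - dual_apply f (a z - b z)\<bar> \<le> e / 4"
          using \<open>e > 0\<close> by (simp add: field_simps)
        have "t * \<bar>dual_apply f (a z - b z)\<bar> \<le> 1 * (e / 8)"
          using le_k[OF f(2) z(1)] f(1) t(1,2) by (intro mult_mono) auto
        moreover have "t * m \<le> t * \<bar>dual_apply f z - dual_apply f (a z - b z)\<bar> + t * \<bar>dual_apply f (a z - b z)\<bar>"
          unfolding z(2) distrib_left[symmetric] using t(1) by (intro mult_left_mono) auto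
        ultimately show False
          using 1 t(3) \<open>e > 0\<close> by simp
      qed
      then show ?thesis using le_m[OF that] by simp
    qed
    then show "f \<in> dual_cone K \<inter> W" using f(2) X(3) by auto
  qed
  then show ?thesis
    using that[of k "e/8"] \<open>k \<in> K\<close> \<open>e > 0\<close> tvs_bounded_subset[OF W(2)] by simp
qed

lemma bPC_of_bounded_slice:
  assumes "tvs_bounded strong_dual ({f. dual_apply f k \<le> l} \<inter> dual_cone K)" and "l > 0"
  shows "zero_in_bPC strong_dual (dual_cone K)"
proof -
  have "nbhd_of_0 weak_star {f. dual_apply f k < l}"
    unfolding nbhd_of_0_def
    using openin_weak_star_less[of k l] \<open>l > 0\<close> by (intro exI[of _ "{f. dual_apply f k < l}"]) auto
  moreover have "tvs_bounded strong_dual (dual_cone K \<inter> {f. dual_apply f k < l})"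
    using assms(1) by (rule tvs_bounded_subset) auto
  ultimately show ?thesis
    unfolding zero_in_bPC_def by blast
qed

text \<open>On the dual cone all summands are nonnegative, so a bound on the sum bounds each of
  them. The level \<open>l/2\<close> turns the weak inequality into the strict one.\<close>

lemma bounded_slice_of_finite_slices:
  assumes K: "convex_cone K" and "l > 0" and k: "\<And>j. j \<in> J \<Longrightarrow> k j \<in> K" and J: "finite J"
    and bdd: "tvs_bounded strong_dual ((\<Inter>j\<in>J. {f. dual_apply f (k j) < l}) \<inter> dual_cone K)"
  shows "(\<Sum>j\<in>J. k j) \<in> K"
    and "tvs_bounded strong_dual ({f. dual_apply f (\<Sum>j\<in>J. k j) \<le> l/2} \<inter> dual_cone K)"
proof -
  show "(\<Sum>j\<in>J. k j) \<in> K"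
    using J k by (induction J rule: finite_induct)
      (auto intro!: convex_cone_add[OF K] convex_cone_contains_0[OF K])
  have "dual_apply f (k j) < l"
    if "dual_apply f (\<Sum>j\<in>J. k j) \<le> l/2" "f \<in> dual_cone K" "j \<in> J" for f j
  proof -
    have "dual_apply f (k j) \<le> dual_apply f (\<Sum>j\<in>J. k j)"
      unfolding dual_apply_point_sum using J that k
      by (intro member_le_sum) (auto intro: dual_cone_nonneg)
    then show ?thesis using that(1) \<open>l > 0\<close> by simp
  qed
  then show "tvs_bounded strong_dual ({f. dual_apply f (\<Sum>j\<in>J. k j) \<le> l/2} \<inter> dual_cone K)"
    by (intro tvs_bounded_subset[OF bdd]) auto
qed

theorem theorem3p15:
  fixes K :: "'a::{locally_convex, t2_space} set"
  assumes "infrabarreled TYPE('a)"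
    and "convex_cone K" and "closed K" and "pointed K"
  shows
    "let
       i = (\<exists>k\<in>K. \<exists>l>0.
              tvs_bounded strong_dual ({f. dual_apply f k \<le> l} \<inter> dual_cone K));
       ii = (zero_in_bPC strong_dual (dual_cone K) \<and> zero_in_s_ext (dual_cone K));
       iii = (zero_in_bPC strong_dual (dual_cone K) \<and> closure (span K) = UNIV);
       iv = (\<exists>n\<ge>1. \<exists>k :: nat \<Rightarrow> 'a. \<exists>l>0. (\<forall>j\<in>{1..n}. k j \<in> K) \<and>
              tvs_bounded strong_dual
                ((\<Inter>j\<in>{1..n}. {f. dual_apply f (k j) < l}) \<inter> dual_cone K))
     in (i \<longleftrightarrow> ii) \<and> (ii \<longleftrightarrow> iii) \<and> (iii \<longleftrightarrow> iv)"
proof -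
  define i where "i \<longleftrightarrow> (\<exists>k\<in>K. \<exists>l>0.
    tvs_bounded strong_dual ({f. dual_apply f k \<le> l} \<inter> dual_cone K))"
  define ii where "ii \<longleftrightarrow> zero_in_bPC strong_dual (dual_cone K) \<and> zero_in_s_ext (dual_cone K)"
  define iii where "iii \<longleftrightarrow> zero_in_bPC strong_dual (dual_cone K) \<and> closure (span K) = UNIV"
  define iv where "iv \<longleftrightarrow> (\<exists>n\<ge>1. \<exists>k :: nat \<Rightarrow> 'a. \<exists>l>0. (\<forall>j\<in>{1..n}. k j \<in> K) \<and>
    tvs_bounded strong_dual ((\<Inter>j\<in>{1..n}. {f. dual_apply f (k j) < l}) \<inter> dual_cone K))"
  \<comment> \<open>The first three statements are linked in a cycle; the fourth is tied to the
    first in both directions.\<close>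
  have "ii" if "i"
    using that bPC_of_bounded_slice s_ext_of_bounded_slice[OF assms(1,2)]
    unfolding i_def ii_def by blast
  moreover have "iii" if "ii"
    using that span_dense_of_s_ext unfolding ii_def iii_def by blast
  moreover have "i" if "iii"
  proof -
    have "zero_in_bPC strong_dual (dual_cone K)" "closure (span K) = UNIV"
      using that unfolding iii_def by auto
    then obtain k l where "k \<in> K" "l > 0"
      "tvs_bounded strong_dual ({f. dual_apply f k \<le> l} \<inter> dual_cone K)"
      by (rule bounded_slice_of_bPC[OF assms(1,2)]) (rule that)
    then show ?thesis unfolding i_def by blast
  qed
  moreover have "iv" if i: "i"
  proof -
    obtain k l where kl: "k \<in> K" "l > 0"
      "tvs_bounded strong_dual ({f. dual_apply f k \<le> l} \<inter> dual_cone K)"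
      using i unfolding i_def by blast
    \<comment> \<open>With \<open>n = 1\<close> the strict slice is contained in the given
      one.\<close>
    have "tvs_bounded strong_dual ((\<Inter>j\<in>{1..1::nat}. {f. dual_apply f k < l}) \<inter> dual_cone K)"
      using kl(3) by (rule tvs_bounded_subset) auto
    then show ?thesis
      unfolding iv_def using kl(1,2)
      by (intro exI[of _ "1::nat"] exI[of _ "\<lambda>_. k"] exI[of _ l] conjI) auto
  qed
  moreover have "i" if iv: "iv"
  proof -
    obtain n l and k :: "nat \<Rightarrow> 'a" where l: "l > 0" and k: "\<And>j. j \<in> {1..n} \<Longrightarrow> k j \<in> K"
      and bdd: "tvs_bounded strong_dual ((\<Inter>j\<in>{1..n}. {f. dual_apply f (k j) < l}) \<inter> dual_cone K)"
      using iv unfolding iv_def by blast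
    show ?thesis
      unfolding i_def
      using bounded_slice_of_finite_slices[OF assms(2) l k finite_atLeastAtMost bdd] l
      by (intro bexI[of _ "\<Sum>j\<in>{1..n}. k j"] exI[of _ "l/2"] conjI) simp_all
  qed
  ultimately show ?thesis
    unfolding Let_def i_def[symmetric] ii_def[symmetric] iii_def[symmetric] iv_def[symmetric]
    by blast
qed

end
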